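(* Let $d\in\mathbb{N}$ and let $P$ be a $d$-dimensional polytope in $\mathbb{R}^d$ with $m$ facets such that $$P=(p_1,\ldots,p_m)_{\ge 0}=(q_1,\ldots,q_d)_{\ge 0},$$ where $p_1,\ldots,p_m,q_1,\ldots,q_d\in\mathbb{R}[x]$ and $p_1,\ldots,p_m$ are of degree one. Then every $p_i$, $i\in\{1,\ldots,m\}$, is a factor of precisely one polynomial $q_j$ with $j\in\{1,\ldots,d\}$. Furthermore, for $i$ and $j$ such that $p_i$ is a factor of $q_j$, the factor $p_i$ of $q_j$ is of odd multiplicity.
   Context: $\mathbb{R}[x]=\mathbb{R}[x_1,\ldots,x_d]$ is the ring of real polynomials in $d$ variables. For $g_1,\ldots,g_k\in\mathbb{R}[x]$, $(g_1,\ldots,g_k)_{\ge 0}=\{x\in\mathbb{R}^d: g_1(x)\ge 0,\ldots,g_k(x)\ge 0\}$. A polytope is the convex hull of a non-empty finite set of points in $\mathbb{R}^d$; facets are its $(d-1)$-dimensional faces. $p$ is a factor of $q$ if $q=pg$ for some $g\in\mathbb{R}[x]$. An irreducible factor $f$ of $q$ has multiplicity $k\in\mathbb{N}$ if $f^k$ is a factor of $q$ but $f^{k+1}$ is not. *)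

theory Defs
  imports "HOL-Analysis.Analysis" "HOL-Library.Poly_Mapping"
    "HOL-Computational_Algebra.Factorial_Ring"
begin

text \<open>
  Real polynomials in the variables \<open>x\<^sub>i\<close>, where \<open>i\<close> ranges over the finite type \<open>'n\<close> that also
  indexes the coordinates of \<open>real ^ 'n\<close>: a finitely supported map from exponent vectors to
  coefficients. Multiplication is convolution, so \<open>dvd\<close>, powers and \<open>irreducible\<close> are those of the
  polynomial ring.
\<close>
type_synonym 'n real_mpoly = "('n \<Rightarrow>\<^sub>0 nat) \<Rightarrow>\<^sub>0 real"

definition mpoly_eval :: "'n::finite real_mpoly \<Rightarrow> real ^ 'n \<Rightarrow> real" where
  "mpoly_eval p x =
     (\<Sum>a\<in>Poly_Mapping.keys p. Poly_Mapping.lookup p a * (\<Prod>i\<in>UNIV. (x $ i) ^ Poly_Mapping.lookup a i))"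

text \<open>Total degree; the zero polynomial gets degree \<open>0\<close>.\<close>
definition mpoly_degree :: "'n::finite real_mpoly \<Rightarrow> nat" where
  "mpoly_degree p =
     Max (insert 0 ((\<lambda>a. \<Sum>i\<in>UNIV. Poly_Mapping.lookup a i) ` Poly_Mapping.keys p))"

definition nonneg_set :: "nat \<Rightarrow> (nat \<Rightarrow> 'n::finite real_mpoly) \<Rightarrow> (real ^ 'n) set" where
  "nonneg_set k g = {x. \<forall>i\<in>{1..k}. mpoly_eval (g i) x \<ge> 0}"

text \<open>
  A relation rather than a function, since no such \<open>k\<close> exists for \<open>q = 0\<close>.
\<close>
definition factor_multiplicity :: "'a::comm_semiring_1 \<Rightarrow> 'a \<Rightarrow> nat \<Rightarrow> bool" where
  "factor_multiplicity f q k \<longleftrightarrow> irreducible f \<and> f dvd q \<and> f ^ k dvd q \<and> \<not> f ^ (k + 1) dvd q"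

end

theory Submission
  imports Defs
begin

text \<open>
  The engine is a lower bound: a polytope of dimension \<open>k\<close> cannot be cut out of its affine hull by
  fewer than \<open>k\<close> polynomial inequalities (\<open>aff_dim_polytope_le_card\<close>). Near a point in the relative
  interior of a facet \<open>F\<close> where no \<open>q\<^sub>j\<close> vanishes, all of them would be positive, so the point would
  be interior to the polytope. Hence the product of the \<open>q\<^sub>j\<close> vanishes on the relative interior of \<open>F\<close>,
  and since polynomials on an affine space form an integral domain, one single \<open>q\<^sub>j\<close> vanishes on the
  whole affine hull of \<open>F\<close> (\<open>ex_vanishing_on_facet\<close>). The remaining inequalities then describe \<open>F\<close>
  inside its affine hull, and induction on the dimension gives the bound.

  Let now \<open>P\<close> be full-dimensional. Applied to the affine polynomials \<open>p\<^sub>i\<close>, the same vanishing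
  statement attaches to each facet some \<open>p\<^sub>i\<close> whose zero set is the affine hull of the facet; as there
  are as many facets as \<open>p\<^sub>i\<close>, every \<open>p\<^sub>i\<close> arises (\<open>facet_hyperplane_surj\<close>). An affine polynomial
  divides exactly those polynomials that vanish on its zero set (\<open>affine_mpoly_dvd_iff\<close>), so \<open>p\<^sub>i\<close>
  divides some \<open>q\<^sub>j\<close>. If it divided two of them, the facet, of dimension \<open>d - 1\<close>, would be described
  by the other \<open>d - 2\<close>, against the lower bound; likewise \<open>q\<^sub>j = 0\<close> would leave only \<open>d - 1\<close>
  inequalities for \<open>P\<close>.

  Finally, the multiplicity must be odd because the sign of \<open>q\<^sub>j\<close> has to change across the facet: at a
  generic point of the facet the other polynomials are positive, so \<open>q\<^sub>j\<close> alone must exclude the far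
  side (\<open>factor_multiplicity_odd\<close>).
\<close>

section \<open>Polynomial functions on affine subspaces\<close>

lemma real_polynomial_function_on_line:
  assumes "real_polynomial_function f"
  shows "\<exists>r. \<forall>t. f (x + t *\<^sub>R v) = poly r t"
  using assms
proof (induction f rule: real_polynomial_function.induct)
  case (linear f)
  then interpret bounded_linear f .
  show ?case by (rule exI[of _ "[:f x, f v:]"]) (simp add: add scaleR)
next
  case (const c)
  show ?case by (rule exI[of _ "[:c:]"]) simp
next
  case (add f g)
  then show ?case by (metis poly_add)
next
  case (mult f g)
  then show ?case by (metis poly_mult)
qed

lemma finite_zeros_on_line:
  assumes "real_polynomial_function f" and "f (x + s *\<^sub>R v) \<noteq> 0"
  shows "finite {t. f (x + t *\<^sub>R v) = 0}"
proof -
  obtain r where r: "\<And>t. f (x + t *\<^sub>R v) = poly r t"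
    using real_polynomial_function_on_line[OF assms(1)] by blast
  with assms(2) have "r \<noteq> 0" by auto
  then show ?thesis by (simp add: r poly_roots_finite)
qed

text \<open>
  An affine space is irreducible, with a density statement added: finitely many polynomials that are
  nonzero on \<open>U\<close> have a common non-zero in every nonempty relatively open part of \<open>U\<close>. To
  add one polynomial, join a common non-zero of the others to a non-zero of the new one; on that line
  each polynomial has finitely many zeros, so small generic times work.
\<close>
lemma ex_common_nonzero:
  fixes f :: "'i \<Rightarrow> 'a::real_normed_vector \<Rightarrow> real"
  assumes "affine U" and T: "openin (top_of_set U) T" "T \<noteq> {}" and "finite J"
    and "\<And>j. j \<in> J \<Longrightarrow> real_polynomial_function (f j)"
    and "\<And>j. j \<in> J \<Longrightarrow> \<exists>u\<in>U. f j u \<noteq> 0"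
  shows "\<exists>x\<in>T. \<forall>j\<in>J. f j x \<noteq> 0"
  using assms(4-)
proof (induction J)
  case empty
  then show ?case using T by auto
next
  case (insert j J)
  then obtain x where x: "x \<in> T" "\<forall>l\<in>J. f l x \<noteq> 0" by auto
  from insert.prems obtain u where u: "u \<in> U" "f j u \<noteq> 0" by auto
  obtain S where S: "open S" "T = U \<inter> S" using T(1) by (auto simp: openin_open)
  let ?line = "\<lambda>t. x + t *\<^sub>R (u - x)"
  have U: "?line t \<in> U" for t
    using mem_affine[OF \<open>affine U\<close>, of x u "1 - t" t] x(1) u(1) S(2)
    by (simp add: algebra_simps)
  have op: "open (?line -` S)"
    by (intro open_vimage continuous_intros S)
  have "0 \<in> ?line -` S" using x(1) S(2) by simp
  then have ne: "?line -` S \<noteq> {}" by blast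
  have fin: "finite (\<Union>l\<in>insert j J. {t. f l (?line t) = 0})"
  proof (intro finite_UN_I)
    fix l assume l: "l \<in> insert j J"
    show "finite {t. f l (?line t) = 0}"
      \<comment> \<open>The line passes through \<open>x\<close> at time \<open>0\<close> and through \<open>u\<close> at time \<open>1\<close>.\<close>
      using l x(2) u(2) insert.prems(1)[OF l]
        finite_zeros_on_line[of "f l" x 0 "u - x"] finite_zeros_on_line[of "f l" x 1 "u - x"]
      by auto
  qed (use insert.hyps in simp)
  obtain t where "t \<in> ?line -` S" "t \<notin> (\<Union>l\<in>insert j J. {t. f l (?line t) = 0})"
    using open_minus_countable[OF countable_finite[OF fin] ne op] by blast
  then show ?case using U[of t] S(2) by (intro bexI[of _ "?line t"]) auto
qed

lemma real_polynomial_function_continuous_on: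
  fixes f :: "'a::real_normed_vector \<Rightarrow> real"
  assumes "real_polynomial_function f"
  shows "continuous_on S f"
  using assms continuous_real_polymonial_function continuous_at_imp_continuous_on by blast

lemma open_positivity_set:
  fixes q :: "'i \<Rightarrow> 'a::real_normed_vector \<Rightarrow> real"
  assumes "finite J" "\<And>j. j \<in> J \<Longrightarrow> real_polynomial_function (q j)"
  shows "open {x. \<forall>j\<in>J. q j x > 0}"
proof -
  have "{x. \<forall>j\<in>J. q j x > 0} = (\<Inter>j\<in>J. {x. q j x > 0})" by auto
  then show ?thesis
    using assms
    by (auto intro!: open_INT open_Collect_less real_polynomial_function_continuous_on)
qed

section \<open>Polynomials describing a polytope\<close>

text \<open>
  If no \<open>q j\<close> vanishes on the affine hull of \<open>F\<close>, a generic point of the relative interior of \<open>F\<close> satisfies all inequalities strictly, and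
  these remain valid nearby in the affine hull of \<open>P\<close>. The point is then in the relative interior
  of \<open>P\<close>, which a proper face does not meet.
\<close>
lemma ex_vanishing_on_facet:
  fixes P :: "'a::euclidean_space set"
  assumes "convex P" "F facet_of P" "finite J"
    and poly: "\<And>j. j \<in> J \<Longrightarrow> real_polynomial_function (q j)"
    and P: "P = {x \<in> affine hull P. \<forall>j\<in>J. q j x \<ge> 0}"
  shows "\<exists>j\<in>J. \<forall>x\<in>affine hull F. q j x = 0"
proof (rule ccontr)
  assume neg: "\<not> ?thesis"
  have F: "F face_of P" "F \<noteq> {}" "F \<noteq> P" using \<open>F facet_of P\<close> by (auto simp: facet_of_def)
  have cF: "convex F" using F(1) face_of_imp_convex by blast
  have "\<exists>x\<in>rel_interior F. \<forall>j\<in>J. q j x \<noteq> 0"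
    by (rule ex_common_nonzero[of "affine hull F"])
      (use neg poly \<open>finite J\<close> F(2) cF in \<open>auto simp: openin_rel_interior rel_interior_eq_empty\<close>)
  then obtain x where x: "x \<in> rel_interior F" "\<forall>j\<in>J. q j x \<noteq> 0" by blast
  have xP: "x \<in> F" "x \<in> P" using x rel_interior_subset F(1) face_of_imp_subset by blast+
  let ?W = "{x. \<forall>j\<in>J. q j x > 0}"
  have "x \<in> ?W" using xP(2) x(2) P by (force simp: less_le)
  moreover have "open ?W" using open_positivity_set[OF \<open>finite J\<close> poly] .
  moreover have "?W \<inter> affine hull P \<subseteq> P" using P by (auto intro: less_imp_le)
  ultimately have "x \<in> rel_interior P"
    unfolding mem_rel_interior using xP by blast
  then show False using face_of_disjoint_rel_interior[OF F(1,3)] xP(1) by blast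
qed

text \<open>
  Inequalities that hold with equality on the affine hull of a face do not constrain the face within
  this hull. The case \<open>F = P\<close> serves to discard zero polynomials.
\<close>
lemma face_description_drop_vanishing:
  fixes P :: "'a::euclidean_space set"
  assumes "convex P" "F face_of P"
    and P: "P = {x \<in> affine hull P. \<forall>j\<in>J. q j x \<ge> (0::real)}"
    and "\<And>j x. j \<in> K \<Longrightarrow> x \<in> affine hull F \<Longrightarrow> q j x = 0"
  shows "F = {x \<in> affine hull F. \<forall>j\<in>J - K. q j x \<ge> 0}"
proof -
  have eq: "F = affine hull F \<inter> P" using face_of_imp_eq_affine_Int assms(1,2) by blast
  have sub: "affine hull F \<subseteq> affine hull P"
    using assms(2) face_of_imp_subset hull_mono by metis
  have "x \<in> F \<longleftrightarrow> x \<in> affine hull F \<and> (\<forall>j\<in>J - K. q j x \<ge> 0)" for x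
  proof -
    have "x \<in> F \<longleftrightarrow> x \<in> affine hull F \<and> (\<forall>j\<in>J. q j x \<ge> 0)" using eq P sub by blast
    then show ?thesis using assms(4) by (metis DiffE DiffI order_refl)
  qed
  then show ?thesis by blast
qed

text \<open>
  Passing to a facet costs one dimension and at least one polynomial, namely one that vanishes on the
  facet. Stating the description relative to the affine hull is what makes it inherited by facets.
\<close>
lemma aff_dim_polytope_le_card:
  fixes P :: "'a::euclidean_space set"
  assumes "polytope P" "finite J"
    and "\<And>j. j \<in> J \<Longrightarrow> real_polynomial_function (q j)"
    and "P = {x \<in> affine hull P. \<forall>j\<in>J. q j x \<ge> 0}"
  shows "aff_dim P \<le> int (card J)"
  using assms
proof (induction "card J" arbitrary: P J rule: less_induct)
  case less
  show ?case
  proof (cases "aff_dim P > 0")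
    case True
    obtain F where F: "F facet_of P"
      using polytope_facet_exists[OF less.prems(1) True] by blast
    have fF: "F face_of P" using F facet_of_imp_face_of by blast
    have cP: "convex P" using less.prems(1) polytope_imp_convex by blast
    obtain j where j: "j \<in> J" "\<forall>x\<in>affine hull F. q j x = 0"
      using ex_vanishing_on_facet[OF cP F less.prems(2-4)] by blast
    have "F = {x \<in> affine hull F. \<forall>l\<in>J - {j}. q l x \<ge> 0}"
      by (rule face_description_drop_vanishing[OF cP fF less.prems(4)]) (use j(2) in auto)
    moreover have card: "card (J - {j}) < card J"
      using j(1) less.prems(2) by (meson card_Diff1_less)
    moreover have "polytope F" using fF less.prems(1) face_of_polytope_polytope by blast
    ultimately have "aff_dim F \<le> int (card (J - {j}))"
      using less.prems(2,3) by (intro less.hyps) auto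
    moreover have "aff_dim F = aff_dim P - 1" using F by (simp add: facet_of_def)
    ultimately show ?thesis using card by linarith
  qed simp
qed

section \<open>Multivariate polynomials and their evaluation\<close>

definition monomial_eval :: "('n::finite \<Rightarrow>\<^sub>0 nat) \<Rightarrow> real ^ 'n \<Rightarrow> real" where
  "monomial_eval a x = (\<Prod>i\<in>UNIV. (x $ i) ^ Poly_Mapping.lookup a i)"

lemma monomial_eval_add: "monomial_eval (a + b) x = monomial_eval a x * monomial_eval b x"
  by (simp add: monomial_eval_def lookup_add power_add prod.distrib)

lemma monomial_eval_zero [simp]: "monomial_eval 0 x = 1"
  by (simp add: monomial_eval_def)

lemma monomial_eval_single: "monomial_eval (Poly_Mapping.single i k) x = (x $ i) ^ k"
proof -
  have "monomial_eval (Poly_Mapping.single i k) x = (\<Prod>j\<in>UNIV. if i = j then (x $ j) ^ k else 1)"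
    unfolding monomial_eval_def by (intro prod.cong) (auto simp: lookup_single when_def)
  then show ?thesis by simp
qed

lemma mpoly_eval_superset:
  assumes "finite K" "Poly_Mapping.keys p \<subseteq> K"
  shows "mpoly_eval p x = (\<Sum>a\<in>K. Poly_Mapping.lookup p a * monomial_eval a x)"
  unfolding mpoly_eval_def monomial_eval_def[symmetric]
  using assms by (intro sum.mono_neutral_left) (auto simp: in_keys_iff)

lemma mpoly_eval_add [simp]: "mpoly_eval (p + q) x = mpoly_eval p x + mpoly_eval q x"
proof -
  have *: "finite (Poly_Mapping.keys p \<union> Poly_Mapping.keys q)" by simp
  show ?thesis
    using mpoly_eval_superset[OF *, of p x] mpoly_eval_superset[OF *, of q x]
      mpoly_eval_superset[OF *, of "p + q" x] keys_add[of p q]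
    by (simp add: lookup_add distrib_right sum.distrib)
qed

lemma mpoly_eval_single: "mpoly_eval (Poly_Mapping.single a c) x = c * monomial_eval a x"
  using mpoly_eval_superset[of "{a}" "Poly_Mapping.single a c" x] by simp

lemma mpoly_eval_0 [simp]: "mpoly_eval 0 x = 0"
  by (simp add: mpoly_eval_def)

lemma mpoly_eval_1 [simp]: "mpoly_eval 1 x = 1"
  by (simp add: mpoly_eval_single flip: single_one)

lemma mpoly_single_add_induct:
  assumes "\<And>a c. Q (Poly_Mapping.single a c)" "\<And>p q. Q p \<Longrightarrow> Q q \<Longrightarrow> Q (p + q)"
  shows "Q (p :: 'n::finite real_mpoly)"
proof (induction p rule: update_induct)
  case const
  show ?case using assms(1)[of 0 0] by simp
next
  case (update f a b)
  have "Poly_Mapping.update a b f = f + Poly_Mapping.single a b"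
    using update.hyps
    by (intro poly_mapping_eqI) (auto simp: lookup_update lookup_add lookup_single when_def in_keys_iff)
  then show ?case using assms update.IH by simp
qed

lemma mpoly_eval_mult [simp]: "mpoly_eval (p * q) x = mpoly_eval p x * mpoly_eval q x"
proof (induction p rule: mpoly_single_add_induct)
  case (1 a c)
  show ?case
    by (induction q rule: mpoly_single_add_induct)
      (simp_all add: mult_single mpoly_eval_single monomial_eval_add algebra_simps)
qed (simp add: algebra_simps)

lemma mpoly_eval_power [simp]: "mpoly_eval (p ^ k) x = mpoly_eval p x ^ k"
  by (induction k) simp_all

lemma mpoly_eval_uminus [simp]: "mpoly_eval (- p) x = - mpoly_eval p x"
  using mpoly_eval_add[of p "- p" x] by simp

lemma mpoly_eval_diff [simp]: "mpoly_eval (p - q) x = mpoly_eval p x - mpoly_eval q x"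
  using mpoly_eval_add[of p "- q" x] by simp

lemma mpoly_eval_prod: "mpoly_eval (\<Prod>i\<in>I. f i) x = (\<Prod>i\<in>I. mpoly_eval (f i) x)"
  by (induction I rule: infinite_finite_induct) simp_all

lemma real_polynomial_function_mpoly_eval: "real_polynomial_function (mpoly_eval p)"
proof -
  have "real_polynomial_function (\<lambda>x::real^'n. x $ i)" for i
    by (intro real_polynomial_function.intros(1) bounded_linear_vec_nth)
  then show ?thesis
    unfolding mpoly_eval_def[abs_def]
    by (intro real_polynomial_function_sum real_polynomial_function_prod
        real_polynomial_function_power real_polynomial_function.intros(2,4)) auto
qed

text \<open>
  Dedekind's argument for the independence of characters: monomials are multiplicative in \<open>x\<close>.
  Subtracting from the relation at the componentwise product of \<open>x\<close> and \<open>y\<close> the value of the monomial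
  \<open>e\<close> at \<open>y\<close> times the relation at \<open>x\<close> gives a relation without \<open>e\<close>, and a suitable \<open>y\<close>
  separates a given monomial from \<open>e\<close>.
\<close>
lemma monomials_linearly_independent:
  fixes c :: "('n::finite \<Rightarrow>\<^sub>0 nat) \<Rightarrow> real"
  assumes "finite K" "\<And>x. (\<Sum>a\<in>K. c a * monomial_eval a x) = 0" "b \<in> K"
  shows "c b = 0"
  using assms
proof (induction K arbitrary: b c)
  case empty
  then show ?case by simp
next
  case (insert e K)
  have K: "c a = 0" if a: "a \<in> K" for a
  proof -
    have "a \<noteq> e" using a insert.hyps by auto
    then obtain i where i: "Poly_Mapping.lookup a i \<noteq> Poly_Mapping.lookup e i"
      by (metis poly_mapping_eqI)
    define y :: "real ^ 'n" where "y = (\<chi> j. if j = i then 2 else 1)"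
    have y: "monomial_eval a y = 2 ^ Poly_Mapping.lookup a i" for a :: "'n \<Rightarrow>\<^sub>0 nat"
    proof -
      have "monomial_eval a y = (\<Prod>j\<in>UNIV. if i = j then 2 ^ Poly_Mapping.lookup a j else 1)"
        unfolding monomial_eval_def y_def by (intro prod.cong) auto
      then show ?thesis by simp
    qed
    have "c a * (monomial_eval a y - monomial_eval e y) = 0"
    proof (rule insert.IH[OF _ a])
      fix x
      have "(\<Sum>a\<in>K. c a * (monomial_eval a y - monomial_eval e y) * monomial_eval a x)
          = (\<Sum>a\<in>insert e K. c a * (monomial_eval a y - monomial_eval e y) * monomial_eval a x)"
        using insert.hyps by simp
      also have "\<dots> = (\<Sum>a\<in>insert e K. c a * monomial_eval a (\<chi> j. x $ j * y $ j))
          - monomial_eval e y * (\<Sum>a\<in>insert e K. c a * monomial_eval a x)"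
        unfolding sum_distrib_left sum_subtractf[symmetric]
        by (intro sum.cong)
          (simp_all add: monomial_eval_def power_mult_distrib prod.distrib algebra_simps)
      also have "\<dots> = 0" using insert.prems(1) by simp
      finally show "(\<Sum>a\<in>K. c a * (monomial_eval a y - monomial_eval e y) * monomial_eval a x) = 0" .
    qed
    then show ?thesis using i by (simp add: y)
  qed
  have "c e = 0"
    using insert.prems(1)[of 1] insert.hyps K by (simp add: monomial_eval_def)
  then show ?case using K insert.prems(2) by auto
qed

text \<open>
  A polynomial is determined by its values, which reduces identities and divisibility in the
  polynomial ring to statements about functions.
\<close>
lemma mpoly_eval_eq_0_iff: "(\<forall>x. mpoly_eval p x = 0) \<longleftrightarrow> p = 0"
proof
  assume "\<forall>x. mpoly_eval p x = 0"
  then have "Poly_Mapping.lookup p a = 0" if "a \<in> Poly_Mapping.keys p" for a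
    using monomials_linearly_independent[of "Poly_Mapping.keys p" "Poly_Mapping.lookup p" a] that
    by (simp add: mpoly_eval_superset[of "Poly_Mapping.keys p"])
  then show "p = 0" by (metis in_keys_iff keys_eq_empty all_not_in_conv)
qed simp

lemma mpoly_eqI: "(\<And>x. mpoly_eval p x = mpoly_eval q x) \<Longrightarrow> p = q"
  using mpoly_eval_eq_0_iff[of "p - q"] by simp

abbreviation mpoly_const :: "real \<Rightarrow> 'n::finite real_mpoly" where
  "mpoly_const c \<equiv> Poly_Mapping.single 0 c"

abbreviation mpoly_var :: "'n::finite \<Rightarrow> 'n real_mpoly" where
  "mpoly_var i \<equiv> Poly_Mapping.single (Poly_Mapping.single i (Suc 0)) 1"

lemma mpoly_eval_const [simp]: "mpoly_eval (mpoly_const c) x = c"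
  by (simp add: mpoly_eval_single)

lemma mpoly_eval_var [simp]: "mpoly_eval (mpoly_var i) x = x $ i"
  by (simp add: mpoly_eval_single monomial_eval_single)

lemma mpoly_ring_induct [case_names const var add mult]:
  assumes const: "\<And>c. Q (mpoly_const c)" and var: "\<And>i. Q (mpoly_var i)"
    and add: "\<And>p q. Q p \<Longrightarrow> Q q \<Longrightarrow> Q (p + q)"
    and mult: "\<And>p q. Q p \<Longrightarrow> Q q \<Longrightarrow> Q (p * q)"
  shows "Q (p :: 'n::finite real_mpoly)"
proof (induction p rule: mpoly_single_add_induct)
  case (1 a c)
  have one: "Q 1" using const[of 1] by simp
  have power: "Q (mpoly_var i ^ k)" for i k
    by (induction k) (auto simp: one var intro: mult)
  have prod: "Q (\<Prod>i\<in>I. mpoly_var i ^ Poly_Mapping.lookup a i)" for I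
    by (induction I rule: infinite_finite_induct) (auto simp: one power intro: mult)
  have "Poly_Mapping.single a c = mpoly_const c * (\<Prod>i\<in>UNIV. mpoly_var i ^ Poly_Mapping.lookup a i)"
    by (rule mpoly_eqI,
        unfold mpoly_eval_mult mpoly_eval_const mpoly_eval_prod mpoly_eval_power mpoly_eval_var)
      (simp add: mpoly_eval_single monomial_eval_def)
  then show ?case using mult[OF const prod] by simp
qed (rule add)

section \<open>Polynomials of degree one\<close>

text \<open>
  The exponent vectors of total degree at most one are \<open>0\<close> and the unit vectors; one of the latter
  has a nonzero coefficient because the maximal degree is attained.
\<close>
lemma mpoly_degree_one_imp_affine:
  assumes "mpoly_degree p = 1"
  obtains c :: real and a :: "real ^ 'n::finite"
  where "a \<noteq> 0" "\<And>x. mpoly_eval p x = c + a \<bullet> x"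
proof -
  let ?deg = "\<lambda>a. \<Sum>i\<in>(UNIV::'n set). Poly_Mapping.lookup a i"
  let ?M = "insert 0 (?deg ` Poly_Mapping.keys p)"
  have Max: "Max ?M = 1" using assms by (simp add: mpoly_degree_def)
  have le: "?deg a \<le> 1" if "a \<in> Poly_Mapping.keys p" for a
    using Max_ge[of ?M "?deg a"] that unfolding Max by auto
  have "1 \<in> ?M" using Max_in[of ?M] unfolding Max by auto
  then obtain e where e: "e \<in> Poly_Mapping.keys p" "?deg e = 1" by auto
  let ?u = "\<lambda>i::'n. Poly_Mapping.single i (Suc 0)"
  have shape: "a = 0 \<or> a \<in> range ?u" if "?deg a \<le> 1" for a
  proof (cases "a = 0")
    case False
    then obtain i where i: "Poly_Mapping.lookup a i \<noteq> 0" by (metis poly_mapping_eqI lookup_zero)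
    have "?deg a = Poly_Mapping.lookup a i + (\<Sum>j\<in>UNIV - {i}. Poly_Mapping.lookup a j)"
      by (simp add: sum.remove)
    with that i
    have "Poly_Mapping.lookup a i = 1" "(\<Sum>j\<in>UNIV - {i}. Poly_Mapping.lookup a j) = 0" by linarith+
    then have "a = ?u i"
      by (intro poly_mapping_eqI) (auto simp: lookup_single when_def)
    then show ?thesis by blast
  qed simp
  have inj: "inj ?u"
    by (rule injI) (metis lookup_single_eq lookup_single_not_eq Suc_not_Zero)
  have u0: "?u i \<noteq> 0" for i by (metis lookup_single_eq lookup_zero Suc_not_Zero)
  define A :: "real ^ 'n" where "A = (\<chi> i. Poly_Mapping.lookup p (?u i))"
  have "mpoly_eval p x = Poly_Mapping.lookup p 0 + A \<bullet> x" for x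
  proof -
    have "Poly_Mapping.keys p \<subseteq> insert 0 (range ?u)" using le shape by blast
    then have "mpoly_eval p x = (\<Sum>a\<in>insert 0 (range ?u). Poly_Mapping.lookup p a * monomial_eval a x)"
      by (intro mpoly_eval_superset) auto
    also have "\<dots> = Poly_Mapping.lookup p 0 + (\<Sum>a\<in>range ?u. Poly_Mapping.lookup p a * monomial_eval a x)"
      by (subst sum.insert) (use u0 in \<open>auto simp: image_iff dest: sym\<close>)
    also have "(\<Sum>a\<in>range ?u. Poly_Mapping.lookup p a * monomial_eval a x) = A \<bullet> x"
      by (simp add: sum.reindex[OF inj] inner_vec_def A_def monomial_eval_single)
    finally show ?thesis .
  qed
  moreover have "A \<noteq> 0"
  proof -
    have "e \<noteq> 0" using e(2) by auto
    then obtain i where "e = ?u i" using shape e(2) by force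
    then have "A $ i \<noteq> 0" using e(1) by (simp add: A_def in_keys_iff)
    then show ?thesis by auto
  qed
  ultimately show thesis using that by blast
qed

text \<open>
  Division with remainder by \<open>p\<close> in a variable \<open>x\<^sub>k\<close> that occurs in \<open>p\<close>: since \<open>p\<close> has degree one in
  \<open>x\<^sub>k\<close>, the remainder can be taken free of \<open>x\<^sub>k\<close>. The zero set of \<open>p\<close> projects onto the space of the
  other variables, so a remainder that vanishes on it is zero. Freeness of \<open>x\<^sub>k\<close> is expressed by
  invariance of the values under translation along the \<open>k\<close>-th axis, which is evidently preserved by
  sums and products.
\<close>
lemma affine_mpoly_dvd_iff:
  fixes p q :: "'n::finite real_mpoly"
  assumes "a \<noteq> 0" and p: "\<And>x. mpoly_eval p x = c + a \<bullet> x"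
  shows "p dvd q \<longleftrightarrow> (\<forall>x. mpoly_eval p x = 0 \<longrightarrow> mpoly_eval q x = 0)"
proof
  assume vanish: "\<forall>x. mpoly_eval p x = 0 \<longrightarrow> mpoly_eval q x = 0"
  obtain k where k: "a $ k \<noteq> 0" using \<open>a \<noteq> 0\<close> by (metis vec_eq_iff zero_index)
  let ?free = "\<lambda>r. \<forall>x t. mpoly_eval r (x + axis k t) = mpoly_eval r x"
  have "\<exists>s r. q = p * s + r \<and> ?free r"
  proof (induction q rule: mpoly_ring_induct)
    case (const c)
    show ?case by (rule exI[of _ 0], rule exI[of _ "mpoly_const c"]) simp
  next
    case (var i)
    show ?case
    proof (cases "i = k")
      case True
      let ?s = "mpoly_const (1 / a $ k)"
      show ?thesis
        by (rule exI[of _ ?s], rule exI[of _ "mpoly_var k - p * ?s"])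
          (use k True in \<open>simp add: p inner_add_right inner_axis field_simps\<close>)
    next
      case False
      show ?thesis
        by (rule exI[of _ 0], rule exI[of _ "mpoly_var i"])
          (use False in \<open>simp add: axis_def\<close>)
    qed
  next
    case (add q1 q2)
    then obtain s1 r1 s2 r2 where "q1 = p * s1 + r1" "?free r1" "q2 = p * s2 + r2" "?free r2"
      by blast
    then have "q1 + q2 = p * (s1 + s2) + (r1 + r2) \<and> ?free (r1 + r2)"
      by (simp add: algebra_simps)
    then show ?case by blast
  next
    case (mult q1 q2)
    then obtain s1 r1 s2 r2 where "q1 = p * s1 + r1" "?free r1" "q2 = p * s2 + r2" "?free r2"
      by blast
    then have "q1 * q2 = p * (s1 * q2 + r1 * s2) + r1 * r2 \<and> ?free (r1 * r2)"
      by (simp add: algebra_simps)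
    then show ?case by blast
  qed
  then obtain s r where q: "q = p * s + r" and free: "?free r" by blast
  have "mpoly_eval r x = 0" for x
  proof -
    define y where "y = x + axis k (- (c + a \<bullet> x) / a $ k)"
    have "mpoly_eval p y = 0" using k by (simp add: p y_def inner_add_right inner_axis)
    then have "mpoly_eval r y = 0" using vanish q by auto
    then show ?thesis using free by (simp add: y_def)
  qed
  then have "r = 0" using mpoly_eval_eq_0_iff by blast
  then show "p dvd q" using q by simp
qed (auto elim!: dvdE)

lemma mpoly_is_unit_if_constant:
  fixes p :: "'n::finite real_mpoly"
  assumes "p \<noteq> 0" "\<And>x y. mpoly_eval p x = mpoly_eval p y"
  shows "p dvd 1"
proof -
  obtain c where c: "\<And>x. mpoly_eval p x = c" using assms(2) by blast
  then have "c \<noteq> 0" using assms(1) mpoly_eval_eq_0_iff by metis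
  then have "1 = p * mpoly_const (1 / c)"
    by (intro mpoly_eqI) (simp add: c)
  then show ?thesis ..
qed

text \<open>
  If both factors of \<open>p\<close> were nonconstant, there would be a line on which both are nonconstant; there
  their product has degree at least two, whereas \<open>p\<close> has degree at most one on every line.
\<close>
lemma irreducible_affine_mpoly:
  fixes p :: "'n::finite real_mpoly"
  assumes "a \<noteq> 0" and p: "\<And>x. mpoly_eval p x = c + a \<bullet> x"
  shows "irreducible p"
proof (rule irreducibleI)
  have nonconst: "mpoly_eval p a \<noteq> mpoly_eval p 0" using \<open>a \<noteq> 0\<close> by (simp add: p)
  then show "p \<noteq> 0" by auto
  have "mpoly_eval p (- (c / (a \<bullet> a)) *\<^sub>R a) = 0" using \<open>a \<noteq> 0\<close> by (simp add: p)
  then show "\<not> p dvd 1"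
    by (metis dvdE mpoly_eval_1 mpoly_eval_mult mult_zero_left zero_neq_one)
  fix f g assume fg: "p = f * g"
  show "f dvd 1 \<or> g dvd 1"
  proof (rule ccontr)
    assume neg: "\<not> ?thesis"
    have nonzero: "f \<noteq> 0" "g \<noteq> 0" using fg \<open>p \<noteq> 0\<close> by auto
    \<comment> \<open>Lines are given by two points. That a factor separates the points is the nonvanishing of a
      polynomial on the space of pairs, so the line comes from the common non-zero of two such.\<close>
    define h where "h b z = mpoly_eval (if b then f else g) (fst z)
      - mpoly_eval (if b then f else g) (snd z)" for b and z :: "(real^'n) \<times> (real^'n)"
    have "\<exists>z\<in>UNIV. \<forall>b\<in>UNIV. h b z \<noteq> 0"
    proof (rule ex_common_nonzero[of UNIV])
      fix b
      have "real_polynomial_function (mpoly_eval r \<circ> (fst :: (real^'n) \<times> (real^'n) \<Rightarrow> _))"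
        "real_polynomial_function (mpoly_eval r \<circ> (snd :: (real^'n) \<times> (real^'n) \<Rightarrow> _))"
        for r :: "'n real_mpoly"
        by (intro real_polynomial_function_compose polynomial_function_bounded_linear
            bounded_linear_fst bounded_linear_snd real_polynomial_function_mpoly_eval)+
      then show "real_polynomial_function (h b)"
        unfolding h_def[abs_def] o_def by (intro real_polynomial_function_diff)
      show "\<exists>z\<in>UNIV. h b z \<noteq> 0"
        using neg nonzero mpoly_is_unit_if_constant[of f] mpoly_is_unit_if_constant[of g]
        by (cases b) (simp_all add: h_def, metis+)
    qed auto
    then obtain x y where xy: "h b (x, y) \<noteq> 0" for b by auto
    obtain rf rg where rf: "\<And>t. mpoly_eval f (x + t *\<^sub>R (y - x)) = poly rf t"
      and rg: "\<And>t. mpoly_eval g (x + t *\<^sub>R (y - x)) = poly rg t"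
      using real_polynomial_function_on_line[OF real_polynomial_function_mpoly_eval] by metis
    have nonconstant: "degree r \<noteq> 0" if "poly r 0 \<noteq> poly r 1" for r :: "real poly"
    proof
      assume "degree r = 0"
      then obtain b where "r = [:b:]" by (rule degree_eq_zeroE)
      then show False using that by simp
    qed
    have "poly rf 0 \<noteq> poly rf 1" "poly rg 0 \<noteq> poly rg 1"
      using xy[of True] xy[of False] by (auto simp: h_def simp flip: rf rg)
    then have deg: "degree rf \<noteq> 0" "degree rg \<noteq> 0"
      by (simp_all only: nonconstant not_False_eq_True)
    have "rf * rg = [:c + a \<bullet> x, a \<bullet> (y - x):]"
      by (rule poly_eq_poly_eq_iff[THEN iffD1], rule ext)
        (simp add: fg[symmetric] p inner_add_right flip: rf rg mpoly_eval_mult)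
    moreover have "degree (rf * rg) = degree rf + degree rg"
      using deg by (intro degree_mult_eq) auto
    ultimately show False using deg degree_pCons_le[of "c + a \<bullet> x" "[:a \<bullet> (y - x):]"] by simp
  qed
qed

text \<open>
  The exponents \<open>k\<close> with \<open>p ^ k dvd q\<close> are bounded by the degree of \<open>q\<close> on a line normal to the
  zero set of \<open>p\<close> on which \<open>q\<close> is not identically zero, because \<open>p\<close> has degree exactly one there.
\<close>
lemma ex_factor_multiplicity:
  fixes p q :: "'n::finite real_mpoly"
  assumes "a \<noteq> 0" and p: "\<And>x. mpoly_eval p x = c + a \<bullet> x" and "p dvd q" "q \<noteq> 0"
  shows "\<exists>k. factor_multiplicity p q k"
proof -
  obtain x where x: "mpoly_eval q x \<noteq> 0" using \<open>q \<noteq> 0\<close> mpoly_eval_eq_0_iff by metis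
  obtain r where r: "\<And>t. mpoly_eval q (x + t *\<^sub>R a) = poly r t"
    using real_polynomial_function_on_line[OF real_polynomial_function_mpoly_eval] by metis
  have "r \<noteq> 0" using x r[of 0] by auto
  let ?l = "[:c + a \<bullet> x, a \<bullet> a:]"
  have bound: "k \<le> degree r" if "p ^ k dvd q" for k
  proof -
    obtain g where g: "q = p ^ k * g" using \<open>p ^ k dvd q\<close> by (elim dvdE)
    obtain s where s: "\<And>t. mpoly_eval g (x + t *\<^sub>R a) = poly s t"
      using real_polynomial_function_on_line[OF real_polynomial_function_mpoly_eval] by metis
    have "r = ?l ^ k * s"
      by (rule poly_eq_poly_eq_iff[THEN iffD1], rule ext)
        (simp add: g p inner_add_right add.assoc flip: r s)
    then have "degree (?l ^ k) \<le> degree r" using \<open>r \<noteq> 0\<close> by (intro dvd_imp_degree_le) auto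
    then show ?thesis using \<open>a \<noteq> 0\<close> by (simp add: degree_power_eq)
  qed
  let ?k = "GREATEST k. p ^ k dvd q"
  have "p ^ ?k dvd q" by (rule GreatestI_nat[of _ 1 "degree r"]) (use bound \<open>p dvd q\<close> in auto)
  moreover have "\<not> p ^ (?k + 1) dvd q"
    using Greatest_le_nat[of "\<lambda>k. p ^ k dvd q" "?k + 1" "degree r"] bound by auto
  ultimately show ?thesis
    using irreducible_affine_mpoly[OF assms(1,2)] \<open>p dvd q\<close> by (auto simp: factor_multiplicity_def)
qed

section \<open>The factors of the defining polynomials\<close>

text \<open>
  Every facet spans the zero set of some \<open>c i + a i \<bullet> x\<close>, and different facets span different
  hyperplanes. The number of facets being the number of inequalities, this injection is onto.
\<close>
lemma facet_hyperplane_surj: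
  fixes P :: "'a::euclidean_space set" and a :: "nat \<Rightarrow> 'a" and c :: "nat \<Rightarrow> real"
  assumes "polytope P" "aff_dim P = DIM('a)"
    and "card {F. F facet_of P} = m"
    and P: "P = {x. \<forall>i\<in>{1..m}. c i + a i \<bullet> x \<ge> 0}"
    and nz: "\<And>i. i \<in> {1..m} \<Longrightarrow> a i \<noteq> 0"
    and i: "i \<in> {1..m}"
  shows "\<exists>F. F facet_of P \<and> affine hull F = {x. c i + a i \<bullet> x = 0}"
proof -
  have cP: "convex P" using assms(1) polytope_imp_convex by blast
  have hull: "affine hull P = UNIV" using assms(2) aff_dim_eq_full by blast
  have hyp: "{x. c i + a i \<bullet> x = 0} = {x. a i \<bullet> x = - c i}" for i by (auto simp: algebra_simps)
  have "\<exists>i\<in>{1..m}. affine hull F = {x. c i + a i \<bullet> x = 0}" if F: "F facet_of P" for F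
  proof -
    have "real_polynomial_function (\<lambda>x. c i + a i \<bullet> x)" for i
      by (intro real_polynomial_function.intros(3) real_polynomial_function.intros(2)
          real_polynomial_function.intros(1) bounded_linear_inner_right)
    then have "\<exists>i\<in>{1..m}. \<forall>x\<in>affine hull F. c i + a i \<bullet> x = 0"
      by (intro ex_vanishing_on_facet[OF cP F]) (use P hull in auto)
    then obtain i where i: "i \<in> {1..m}" "\<forall>x\<in>affine hull F. c i + a i \<bullet> x = 0" by blast
    have "affine hull F = {x. c i + a i \<bullet> x = 0}"
    proof (rule affine_dim_equal)
      show "affine {x. c i + a i \<bullet> x = 0}" unfolding hyp by (rule affine_hyperplane)
      show "affine hull F \<noteq> {}" using F by (auto simp: facet_of_def)
      show "aff_dim (affine hull F) = aff_dim {x. c i + a i \<bullet> x = 0}"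
        using F nz[OF i(1)] assms(2) unfolding hyp
        by (simp add: facet_of_def of_nat_diff DIM_ge_Suc0)
    qed (use i in auto)
    then show ?thesis using i(1) by blast
  qed
  then obtain \<iota> where \<iota>: "\<And>F. F facet_of P \<Longrightarrow> \<iota> F \<in> {1..m}"
    "\<And>F. F facet_of P \<Longrightarrow> affine hull F = {x. c (\<iota> F) + a (\<iota> F) \<bullet> x = 0}"
    by metis
  have "inj_on \<iota> {F. F facet_of P}"
  proof (rule inj_onI)
    fix F G assume "F \<in> {F. F facet_of P}" "G \<in> {F. F facet_of P}" "\<iota> F = \<iota> G"
    then have "affine hull F = affine hull G" "F face_of P" "G face_of P"
      using \<iota>(2) facet_of_imp_face_of by auto
    then show "F = G" using face_of_imp_eq_affine_Int[OF cP] by metis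
  qed
  then have "\<iota> ` {F. F facet_of P} = {1..m}"
    using \<iota>(1) assms(3) by (intro card_subset_eq) (auto simp: card_image)
  then have "i \<in> \<iota> ` {F. F facet_of P}" using i by simp
  then obtain F where "F facet_of P" "\<iota> F = i" by blast
  then show ?thesis using \<iota>(2) by blast
qed

text \<open>
  Write \<open>q j = p ^ k * g\<close> and suppose that \<open>k\<close> is even. At a generic point \<open>x\<close> of the relative
  interior of \<open>F\<close>, neither \<open>g\<close> nor any other \<open>q l\<close> vanishes. Points of \<open>P\<close> close to \<open>x\<close> and off the
  hyperplane force \<open>g\<close> to be positive at \<open>x\<close>. Then all inequalities hold in a neighbourhood of \<open>x\<close>,
  although \<open>x\<close> is a boundary point of \<open>P\<close>.
\<close>
lemma factor_multiplicity_odd: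
  fixes p :: "'n::finite real_mpoly" and q :: "'i \<Rightarrow> 'n real_mpoly"
  assumes "convex P" "F facet_of P" "finite J"
    and P: "P = {x. \<forall>j\<in>J. mpoly_eval (q j) x \<ge> 0}"
    and "a \<noteq> 0" and p: "\<And>x. mpoly_eval p x = c + a \<bullet> x"
    and hull: "affine hull F = {x. mpoly_eval p x = 0}"
    and j: "j \<in> J" "\<And>l. l \<in> J \<Longrightarrow> l \<noteq> j \<Longrightarrow> \<not> p dvd q l"
    and mult: "factor_multiplicity p (q j) k"
  shows "odd k"
proof
  assume "even k"
  obtain g where g: "q j = p ^ k * g"
    using mult by (auto simp: factor_multiplicity_def)
  have "\<not> p dvd g"
  proof
    assume "p dvd g"
    then have "p ^ (k + 1) dvd q j" by (simp add: g mult.commute mult_dvd_mono)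
    then show False using mult by (simp add: factor_multiplicity_def)
  qed
  \<comment> \<open>Dropping the even power of \<open>p\<close> leaves no polynomial vanishing on the hyperplane.\<close>
  define h where "h = q(j := g)"
  have F: "F face_of P" "F \<noteq> {}" "F \<noteq> P" using \<open>F facet_of P\<close> by (auto simp: facet_of_def)
  have cF: "convex F" using F(1) face_of_imp_convex by blast
  have Feq: "F = affine hull F \<inter> P" using face_of_imp_eq_affine_Int assms(1) F(1) by blast
  have "\<exists>x\<in>rel_interior F. \<forall>l\<in>J. mpoly_eval (h l) x \<noteq> 0"
  proof (rule ex_common_nonzero[of "affine hull F"])
    fix l assume "l \<in> J"
    then have "\<not> p dvd h l" using j(2) \<open>\<not> p dvd g\<close> by (simp add: h_def)
    then show "\<exists>u\<in>affine hull F. mpoly_eval (h l) u \<noteq> 0"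
      using affine_mpoly_dvd_iff[OF \<open>a \<noteq> 0\<close> p] hull by auto
  qed (use F(2) cF \<open>finite J\<close> in
      \<open>auto simp: openin_rel_interior rel_interior_eq_empty real_polynomial_function_mpoly_eval\<close>)
  then obtain x where x: "x \<in> rel_interior F" "\<forall>l\<in>J. mpoly_eval (h l) x \<noteq> 0" by blast
  have xP: "x \<in> F" "x \<in> P" using x(1) rel_interior_subset F(1) face_of_imp_subset by blast+
  have "mpoly_eval g x > 0"
  proof (rule ccontr)
    assume "\<not> ?thesis"
    then have "mpoly_eval g x < 0" using x(2) j(1) by (force simp: h_def)
    moreover have "open {y. mpoly_eval g y < 0}"
      by (intro open_Collect_less real_polynomial_function_continuous_on
          real_polynomial_function_mpoly_eval continuous_on_const)
    moreover have "x \<in> closure (rel_interior P)"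
      using xP(2) \<open>convex P\<close> closure_subset convex_closure_rel_interior by blast
    ultimately obtain y where y: "y \<in> rel_interior P" "mpoly_eval g y < 0"
      by (auto simp: closure_iff_nhds_not_empty)
    have yP: "y \<in> P" using y(1) rel_interior_subset by blast
    then have "mpoly_eval p y \<noteq> 0"
      using face_of_disjoint_rel_interior[OF F(1,3)] y(1) Feq hull by blast
    then have "mpoly_eval p y ^ k > 0" using \<open>even k\<close> by (simp add: zero_less_power_eq)
    then have "mpoly_eval (q j) y < 0" using y(2) by (simp add: g mult_less_0_iff)
    then show False using yP P j(1) by (auto simp: not_less[symmetric])
  qed
  have pos: "mpoly_eval (h l) x > 0" if "l \<in> J" for l
    using that x(2) xP(2) P \<open>mpoly_eval g x > 0\<close> by (cases "l = j") (force simp: h_def less_le)+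
  let ?W = "{y. \<forall>l\<in>J. mpoly_eval (h l) y > 0}"
  have "open ?W" using \<open>finite J\<close> real_polynomial_function_mpoly_eval by (intro open_positivity_set)
  moreover have "?W \<subseteq> P"
  proof
    fix y assume y: "y \<in> ?W"
    have "mpoly_eval (q l) y \<ge> 0" if "l \<in> J" for l
      using y that \<open>even k\<close> by (cases "l = j") (force simp: h_def g zero_le_even_power)+
    then show "y \<in> P" using P by simp
  qed
  ultimately have "x \<in> interior P" using pos by (auto intro!: interiorI)
  then show False using face_of_disjoint_interior[OF F(1,3)] xP(1) by blast
qed

theorem corollary1p5:
  fixes P :: "(real ^ 'n::finite) set"
    and m :: nat
    and p q :: "nat \<Rightarrow> 'n real_mpoly"
  assumes "polytope P"
    and "aff_dim P = int CARD('n)"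
    and "card {F. F facet_of P} = m"
    and "P = nonneg_set m p"
    and "P = nonneg_set CARD('n) q"
    and "\<forall>i\<in>{1..m}. mpoly_degree (p i) = 1"
  shows "(\<forall>i\<in>{1..m}. \<exists>!j. j \<in> {1..CARD('n)} \<and> p i dvd q j) \<and>
         (\<forall>i\<in>{1..m}. \<forall>j\<in>{1..CARD('n)}. p i dvd q j \<longrightarrow>
            (\<exists>k. factor_multiplicity (p i) (q j) k \<and> odd k))"
proof -
  let ?J = "{1..CARD('n)}"
  have cP: "convex P" using assms(1) polytope_imp_convex by blast
  have hullP: "affine hull P = UNIV" using assms(2) aff_dim_eq_full by force
  have Pq: "P = {x. \<forall>j\<in>?J. mpoly_eval (q j) x \<ge> 0}" using assms(5) by (simp add: nonneg_set_def)
  have Pq': "P = {x \<in> affine hull P. \<forall>j\<in>?J. mpoly_eval (q j) x \<ge> 0}"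
    using Pq hullP by simp
  have "\<exists>c a. a \<noteq> 0 \<and> (\<forall>x. mpoly_eval (p i) x = c + a \<bullet> x)" if "i \<in> {1..m}" for i
    using mpoly_degree_one_imp_affine[of "p i"] assms(6) that by metis
  then obtain c a where a: "\<And>i. i \<in> {1..m} \<Longrightarrow> a i \<noteq> 0"
    and p: "\<And>i x. i \<in> {1..m} \<Longrightarrow> mpoly_eval (p i) x = c i + a i \<bullet> x"
    by metis
  have Pp: "P = {x. \<forall>i\<in>{1..m}. c i + a i \<bullet> x \<ge> 0}"
    using assms(4) p by (simp add: nonneg_set_def)
  have "(\<exists>!j. j \<in> ?J \<and> p i dvd q j) \<and>
    (\<forall>j\<in>?J. p i dvd q j \<longrightarrow> (\<exists>k. factor_multiplicity (p i) (q j) k \<and> odd k))"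
    if i: "i \<in> {1..m}" for i
  proof -
    obtain F where F: "F facet_of P" and "affine hull F = {x. c i + a i \<bullet> x = 0}"
      using facet_hyperplane_surj[OF assms(1) _ assms(3) Pp a i] assms(2) by auto
    then have hull: "affine hull F = {x. mpoly_eval (p i) x = 0}" using p[OF i] by simp
    have fF: "F face_of P" using F facet_of_imp_face_of by blast
    have dvd_iff: "p i dvd r \<longleftrightarrow> (\<forall>x\<in>affine hull F. mpoly_eval r x = 0)" for r
      using affine_mpoly_dvd_iff[OF a[OF i] p[OF i]] hull by simp
    have ex: "\<exists>j\<in>?J. p i dvd q j"
      unfolding dvd_iff
      by (rule ex_vanishing_on_facet[OF cP F _ real_polynomial_function_mpoly_eval Pq']) simp
    have unique: "j = l" if "j \<in> ?J" "l \<in> ?J" "p i dvd q j" "p i dvd q l" for j l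
    proof (rule ccontr)
      assume "j \<noteq> l"
      have "F = {x \<in> affine hull F. \<forall>r\<in>?J - {j, l}. mpoly_eval (q r) x \<ge> 0}"
        using that dvd_iff by (intro face_description_drop_vanishing[OF cP fF Pq']) auto
      then have "aff_dim F \<le> int (card (?J - {j, l}))"
        using face_of_polytope_polytope[OF assms(1) fF] real_polynomial_function_mpoly_eval
        by (intro aff_dim_polytope_le_card) auto
      moreover have "card (?J - {j, l}) = CARD('n) - 2"
        using that \<open>j \<noteq> l\<close> by (simp add: card_Diff_subset)
      moreover have "card {j, l} \<le> card ?J" using that by (intro card_mono) auto
      ultimately show False
        using F assms(2) \<open>j \<noteq> l\<close> by (simp add: facet_of_def)
    qed
    have "\<exists>k. factor_multiplicity (p i) (q j) k \<and> odd k" if j: "j \<in> ?J" "p i dvd q j" for j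
    proof -
      have "q j \<noteq> 0"
      proof
        assume "q j = 0"
        have "P = {x \<in> affine hull P. \<forall>l\<in>?J - {j}. mpoly_eval (q l) x \<ge> 0}"
          by (rule face_description_drop_vanishing[OF cP face_of_refl[OF cP] Pq'])
            (use \<open>q j = 0\<close> in simp)
        then have "aff_dim P \<le> int (card (?J - {j}))"
          using assms(1) real_polynomial_function_mpoly_eval
          by (intro aff_dim_polytope_le_card) auto
        moreover have "card (?J - {j}) < card ?J"
          using j(1) by (meson card_Diff1_less finite_atLeastAtMost)
        ultimately show False using assms(2) by simp
      qed
      then obtain k where k: "factor_multiplicity (p i) (q j) k"
        using ex_factor_multiplicity[OF a[OF i] p[OF i] j(2)] by blast
      moreover have "\<not> p i dvd q l" if "l \<in> ?J" "l \<noteq> j" for l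
        using unique[OF that(1) j(1) _ j(2)] that(2) by blast
      then have "odd k"
        by (rule factor_multiplicity_odd[OF cP F finite_atLeastAtMost Pq a[OF i] p[OF i] hull j(1) _ k])
      ultimately show ?thesis by blast
    qed
    moreover have "\<exists>!j. j \<in> ?J \<and> p i dvd q j"
    proof (rule ex_ex1I)
      show "\<exists>j. j \<in> ?J \<and> p i dvd q j" using ex by blast
    qed (elim conjE, rule unique)
    ultimately show ?thesis by blast
  qed
  then show ?thesis by blast
qed

end
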